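(* Let $k\in\mathbb{N}$, let $0=d_0<d_1<\ldots<d_k$ be real numbers, let $p_0,p_1,\ldots,p_k\in\,]0,1[$ be such that $p_0+p_1+\ldots+p_k=1$, and let $\theta=p_0\cdot\delta_0+p_1\cdot\delta_{d_1}+\ldots+p_k\cdot\delta_{d_k}$. Then there exists a compact measured metric space $(S,d,\mu)$ that achieves $\theta$.
   Context: Notation: $\mathbb{N}=\{0,1,2,\ldots\}$, $\mathbb{R}_+=[0,\infty[$, $]0,1[$ is the open unit interval, and $\delta_x$ is the Dirac mass at $x$. A compact measured metric space is a compact metric space $(S,d)$ endowed with a Borel probability measure $\mu$ on $S$. For a Borel probability measure $\mu$ on a complete separable metric space $(S,d)$, and for a Borel probability measure $\theta$ on $\mathbb{R}_+$, we say that $(S,d,\mu)$ achieves $\theta$ if, for $\xi_1,\xi_2$ independent random variables with distribution $\mu$, the random variable $d(\xi_1,\xi_2)$ has distribution $\theta$. *)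

theory Defs
  imports "HOL-Probability.Probability"
begin

definition borel_probability_on :: "'a topology \<Rightarrow> 'a measure \<Rightarrow> bool" where
  "borel_probability_on X \<mu> \<longleftrightarrow>
     prob_space \<mu> \<and> space \<mu> = topspace X \<and> sets \<mu> = sigma_sets (topspace X) {U. openin X U}"

definition compact_measured_metric_space ::
    "'a set \<Rightarrow> ('a \<Rightarrow> 'a \<Rightarrow> real) \<Rightarrow> 'a measure \<Rightarrow> bool" where
  "compact_measured_metric_space S d \<mu> \<longleftrightarrow>
     Metric_space S d \<and> compact_space (Metric_space.mtopology S d) \<and>
     borel_probability_on (Metric_space.mtopology S d) \<mu>"

abbreviation borel_Rplus :: "real measure" where
  "borel_Rplus \<equiv> restrict_space borel {0..}"

(* HOL cannot quantify over the type carrying the underlying probability space.  The type 'a \<times> 'a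
   is large enough: it carries \<mu> \<Otimes>\<^sub>M \<mu> with its two (independent) projections, and the law of
   d (\<xi>1, \<xi>2) does not depend on the choice of \<Omega>; see achieves_iff_distr_pair and
   distr_indep_eq_distr_pair below.  The notion is meant for a Borel probability \<mu> on a
   complete separable metric space (S, d). *)
definition achieves ::
    "'a set \<Rightarrow> ('a \<Rightarrow> 'a \<Rightarrow> real) \<Rightarrow> 'a measure \<Rightarrow> real measure \<Rightarrow> bool" where
  "achieves S d \<mu> \<theta> \<longleftrightarrow>
     Metric_space S d \<and> borel_probability_on (Metric_space.mtopology S d) \<mu> \<and>
     (\<forall>(\<Omega> :: ('a \<times> 'a) measure) \<xi>1 \<xi>2.
        prob_space \<Omega> \<and> prob_space.indep_var \<Omega> \<mu> \<xi>1 \<mu> \<xi>2 \<and>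
        distr \<Omega> \<mu> \<xi>1 = \<mu> \<and> distr \<Omega> \<mu> \<xi>2 = \<mu> \<longrightarrow>
        (\<lambda>\<omega>. d (\<xi>1 \<omega>) (\<xi>2 \<omega>)) \<in> measurable \<Omega> borel_Rplus \<and>
        distr \<Omega> borel_Rplus (\<lambda>\<omega>. d (\<xi>1 \<omega>) (\<xi>2 \<omega>)) = \<theta>)"

definition dirac_mixture :: "nat \<Rightarrow> (nat \<Rightarrow> real) \<Rightarrow> (nat \<Rightarrow> real) \<Rightarrow> real measure" where
  "dirac_mixture k p x =
     measure_of {0..} (sets borel_Rplus)
       (\<lambda>A. \<Sum>i\<le>k. ennreal (p i) * emeasure (return borel_Rplus (x i)) A)"

lemma space_dirac_mixture [simp]: "space (dirac_mixture k p x) = {0..}"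
  by (simp add: dirac_mixture_def space_measure_of_conv)

lemma sets_dirac_mixture [simp]: "sets (dirac_mixture k p x) = sets borel_Rplus"
proof -
  have "sets (dirac_mixture k p x) = sigma_sets (space borel_Rplus) (sets borel_Rplus)"
    unfolding dirac_mixture_def
    by (subst sets_measure_of) (auto simp: space_restrict_space sets_restrict_space)
  then show ?thesis
    by (simp only: sets.sigma_sets_eq)
qed

lemma emeasure_dirac_mixture:
  assumes "A \<in> sets borel_Rplus"
  shows "emeasure (dirac_mixture k p x) A =
           (\<Sum>i\<le>k. ennreal (p i) * emeasure (return borel_Rplus (x i)) A)"
  unfolding dirac_mixture_def
proof (rule emeasure_measure_of_sigma)
  show "sigma_algebra {0..} (sets borel_Rplus)"
    using sets.sigma_algebra_axioms[of borel_Rplus] by (simp add: space_restrict_space)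
  let ?m = "\<lambda>A. \<Sum>i\<le>k. ennreal (p i) * emeasure (return borel_Rplus (x i)) A"
  show "positive (sets borel_Rplus) ?m"
    by (simp add: positive_def)
  show "countably_additive (sets borel_Rplus) ?m"
  proof (rule countably_additiveI)
    fix F :: "nat \<Rightarrow> real set"
    assume F: "range F \<subseteq> sets borel_Rplus" "disjoint_family F" "\<Union>(range F) \<in> sets borel_Rplus"
    have "(\<Sum>n. ?m (F n)) = (\<Sum>i\<le>k. \<Sum>n. ennreal (p i) * emeasure (return borel_Rplus (x i)) (F n))"
      by (rule suminf_sum) simp
    also have "\<dots> = ?m (\<Union>(range F))"
      using F by (intro sum.cong refl) (simp add: suminf_emeasure del: emeasure_return)
    finally show "(\<Sum>n. ?m (F n)) = ?m (\<Union>(range F))" .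
  qed
qed fact

lemma distr_indep_eq_distr_pair:
  assumes \<Omega>: "prob_space \<Omega>"
    and ind: "prob_space.indep_var \<Omega> \<mu> \<xi>1 \<mu> \<xi>2"
    and law: "distr \<Omega> \<mu> \<xi>1 = \<mu>" "distr \<Omega> \<mu> \<xi>2 = \<mu>"
    and d: "(\<lambda>(x, y). d x y) \<in> measurable (\<mu> \<Otimes>\<^sub>M \<mu>) N"
  shows "(\<lambda>\<omega>. d (\<xi>1 \<omega>) (\<xi>2 \<omega>)) \<in> measurable \<Omega> N"
    and "distr \<Omega> N (\<lambda>\<omega>. d (\<xi>1 \<omega>) (\<xi>2 \<omega>)) = distr (\<mu> \<Otimes>\<^sub>M \<mu>) N (\<lambda>(x, y). d x y)"
proof -
  interpret prob_space \<Omega> by fact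
  have rv: "\<xi>1 \<in> measurable \<Omega> \<mu>" "\<xi>2 \<in> measurable \<Omega> \<mu>"
    and pair: "\<mu> \<Otimes>\<^sub>M \<mu> = distr \<Omega> (\<mu> \<Otimes>\<^sub>M \<mu>) (\<lambda>\<omega>. (\<xi>1 \<omega>, \<xi>2 \<omega>))"
    using ind law by (simp_all add: indep_var_distribution_eq)
  have P: "(\<lambda>\<omega>. (\<xi>1 \<omega>, \<xi>2 \<omega>)) \<in> measurable \<Omega> (\<mu> \<Otimes>\<^sub>M \<mu>)"
    using rv by measurable
  have comp: "(\<lambda>(x, y). d x y) \<circ> (\<lambda>\<omega>. (\<xi>1 \<omega>, \<xi>2 \<omega>)) = (\<lambda>\<omega>. d (\<xi>1 \<omega>) (\<xi>2 \<omega>))"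
    by auto
  show "(\<lambda>\<omega>. d (\<xi>1 \<omega>) (\<xi>2 \<omega>)) \<in> measurable \<Omega> N"
    using measurable_comp[OF P d] by (simp only: comp)
  have "distr (\<mu> \<Otimes>\<^sub>M \<mu>) N (\<lambda>(x, y). d x y) =
        distr (distr \<Omega> (\<mu> \<Otimes>\<^sub>M \<mu>) (\<lambda>\<omega>. (\<xi>1 \<omega>, \<xi>2 \<omega>))) N (\<lambda>(x, y). d x y)"
    by (subst (1) pair) (rule refl)
  also have "\<dots> = distr \<Omega> N (\<lambda>\<omega>. d (\<xi>1 \<omega>) (\<xi>2 \<omega>))"
    using distr_distr[OF d P] by (simp only: comp)
  finally show "distr \<Omega> N (\<lambda>\<omega>. d (\<xi>1 \<omega>) (\<xi>2 \<omega>)) = distr (\<mu> \<Otimes>\<^sub>M \<mu>) N (\<lambda>(x, y). d x y)" ..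
qed

lemma achieves_iff_distr_pair:
  assumes "Metric_space S d"
    and bp: "borel_probability_on (Metric_space.mtopology S d) \<mu>"
    and d: "(\<lambda>(x, y). d x y) \<in> measurable (\<mu> \<Otimes>\<^sub>M \<mu>) borel_Rplus"
  shows "achieves S d \<mu> \<theta> \<longleftrightarrow> distr (\<mu> \<Otimes>\<^sub>M \<mu>) borel_Rplus (\<lambda>(x, y). d x y) = \<theta>"
proof
  interpret mu: prob_space \<mu>
    using bp by (simp add: borel_probability_on_def)
  interpret mu2: pair_prob_space \<mu> \<mu> ..
  have proj: "distr (\<mu> \<Otimes>\<^sub>M \<mu>) \<mu> fst = \<mu>" "distr (\<mu> \<Otimes>\<^sub>M \<mu>) \<mu> snd = \<mu>"
  proof -
    show "distr (\<mu> \<Otimes>\<^sub>M \<mu>) \<mu> fst = \<mu>"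
      by (intro measure_eqI)
         (auto simp: emeasure_distr space_pair_measure fst_vimage_eq_Times Times_Int_Times
            mu.emeasure_pair_measure_Times mu.emeasure_space_1 sets.sets_into_space Int_absorb2)
    show "distr (\<mu> \<Otimes>\<^sub>M \<mu>) \<mu> snd = \<mu>"
      by (intro measure_eqI)
         (auto simp: emeasure_distr space_pair_measure snd_vimage_eq_Times Times_Int_Times
            mu.emeasure_pair_measure_Times mu.emeasure_space_1 sets.sets_into_space Int_absorb2)
  qed
  have ind: "mu2.indep_var \<mu> fst \<mu> snd"
    by (simp add: mu2.indep_var_distribution_eq proj distr_id2)
  assume "achieves S d \<mu> \<theta>"
  then have "distr (\<mu> \<Otimes>\<^sub>M \<mu>) borel_Rplus (\<lambda>\<omega>. d (fst \<omega>) (snd \<omega>)) = \<theta>"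
    unfolding achieves_def using mu2.prob_space_axioms ind proj by blast
  then show "distr (\<mu> \<Otimes>\<^sub>M \<mu>) borel_Rplus (\<lambda>(x, y). d x y) = \<theta>"
    by (simp add: case_prod_unfold)
next
  assume "distr (\<mu> \<Otimes>\<^sub>M \<mu>) borel_Rplus (\<lambda>(x, y). d x y) = \<theta>"
  then show "achieves S d \<mu> \<theta>"
    unfolding achieves_def
    using assms(1) bp distr_indep_eq_distr_pair[OF _ _ _ _ d] by metis
qed

end

theory Submission
  imports Defs
begin

text \<open>
  The space is a finite ultrametric space, and the order of the numbers \<open>d i\<close> is the only thing
  about them that matters. If \<open>l\<close> is an ultrametric with values in \<open>{0, \<dots>, k}\<close>, then
  \<open>d (l x y)\<close> is again an ultrametric, since \<open>d\<close> is increasing and \<open>d 0 = 0\<close>; so it suffices to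
  realise the law that gives mass \<open>p i\<close> to the integer \<open>i\<close> as the law of \<open>l\<close> between two
  independent points (\<open>exists_ultrametric_law\<close>).

  This goes by induction on the largest possible distance \<open>k + 1\<close>. Let \<open>Q\<close> be the wanted law and
  \<open>t = 1 - Q {k + 1} > 0\<close>. Take a finite space whose distance law is \<open>Q\<close> conditioned on
  \<open>{0, \<dots>, k}\<close>, and a finitely supported distribution \<open>r\<close> for which two independent
  samples coincide with probability \<open>t\<close> (\<open>exists_pmf_collision\<close>). Place one copy of the space at
  every atom of \<open>r\<close>, weighted by \<open>r\<close>, with distance \<open>k + 1\<close> between different copies. Two
  independent points fall into the same copy with probability \<open>t\<close>, and are then at a distance
  distributed like the conditioned law; otherwise their distance is \<open>k + 1\<close>
  (\<open>distance_law_glue\<close>). The result is \<open>Q\<close>. The hypothesis \<open>p 0 > 0\<close> guarantees both \<open>t > 0\<close> and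
  that \<open>0\<close> keeps positive mass in the conditioned law, down to the one-point space.
\<close>

section \<open>Ultrametrics and the law of the distance of two random points\<close>

text \<open>
  Only the order of the values and the zero enter, so that distances may be ranks rather than real
  numbers.
\<close>
definition ultrametric_on :: "'a set \<Rightarrow> ('a \<Rightarrow> 'a \<Rightarrow> 'b::{linorder,zero}) \<Rightarrow> bool" where
  "ultrametric_on S l \<longleftrightarrow>
     (\<forall>x\<in>S. \<forall>y\<in>S. 0 \<le> l x y \<and> (l x y = 0 \<longleftrightarrow> x = y) \<and> l x y = l y x) \<and>
     (\<forall>x\<in>S. \<forall>y\<in>S. \<forall>z\<in>S. l x z \<le> max (l x y) (l y z))"

text \<open>
  For \<open>l\<close> the equality relation, this is the law of the event that two independent samples of \<open>M\<close>
  coincide.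
\<close>
definition distance_law :: "'a pmf \<Rightarrow> ('a \<Rightarrow> 'a \<Rightarrow> 'b) \<Rightarrow> 'b pmf" where
  "distance_law M l = map_pmf (\<lambda>(x, y). l x y) (pair_pmf M M)"

lemma set_distance_law: "set_pmf (distance_law M l) = {l x y |x y. x \<in> set_pmf M \<and> y \<in> set_pmf M}"
  by (auto simp: distance_law_def image_iff)

lemma distance_law_map:
  assumes "inj f"
  shows "distance_law (map_pmf f M) (\<lambda>x y. l (inv f x) (inv f y)) = distance_law M l"
proof -
  have "distance_law (map_pmf f M) (\<lambda>x y. l (inv f x) (inv f y)) =
        map_pmf (\<lambda>(x, y). l (inv f (f x)) (inv f (f y))) (pair_pmf M M)"
    by (simp add: distance_law_def map_pair[symmetric] pmf.map_comp comp_def case_prod_unfold)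
  then show ?thesis using assms by (simp add: distance_law_def inv_f_f)
qed

lemma ultrametric_on_image:
  assumes "inj f" "ultrametric_on S l"
  shows "ultrametric_on (f ` S) (\<lambda>x y. l (inv f x) (inv f y))"
  using assms unfolding ultrametric_on_def by (auto simp: inv_f_f inj_eq)

section \<open>Collision probabilities\<close>

lemma exists_pmf_finite_support:
  fixes f :: "'a \<Rightarrow> real"
  assumes "finite A" "\<And>i. i \<in> A \<Longrightarrow> 0 \<le> f i" "(\<Sum>i\<in>A. f i) = 1"
  shows "\<exists>q. (\<forall>i. pmf q i = (if i \<in> A then f i else 0)) \<and> set_pmf q \<subseteq> A"
proof -
  define g where "g i = (if i \<in> A then f i else 0)" for i
  have g0: "0 \<le> g i" for i using assms(2) by (simp add: g_def)
  have "(\<integral>\<^sup>+ i. ennreal (g i) \<partial>count_space UNIV) = (\<Sum>i\<in>A. ennreal (g i))"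
    by (rule nn_integral_count_space') (auto simp: g_def assms(1))
  also have "\<dots> = ennreal (\<Sum>i\<in>A. g i)"
    by (rule sum_ennreal[OF g0])
  also have "(\<Sum>i\<in>A. g i) = 1" using assms(3) by (simp add: g_def)
  finally have "pmf (embed_pmf g) i = g i" for i
    using g0 by (intro pmf_embed_pmf) auto
  then show ?thesis
    by (intro exI[of _ "embed_pmf g"]) (auto simp: g_def set_pmf_iff split: if_splits)
qed

text \<open>
  Give mass \<open>a\<close> to one point and share the rest equally among \<open>N\<close> others. As \<open>a\<close> grows from
  \<open>1 / (N + 1)\<close> to \<open>1\<close>, the collision probability moves continuously from \<open>1 / (N + 1)\<close>
  (uniform distribution) to \<open>1\<close>, so a large \<open>N\<close> makes it pass through \<open>t\<close>.
\<close>
lemma exists_pmf_collision: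
  fixes t :: real
  assumes "0 < t" "t \<le> 1"
  shows "\<exists>r :: nat pmf. finite (set_pmf r) \<and> distance_law r (=) = bernoulli_pmf t"
proof -
  obtain n where n: "inverse (real (Suc n)) < t"
    using reals_Archimedean[OF assms(1)] by blast
  define N where "N = real (Suc n)"
  have N: "N \<ge> 1" by (simp add: N_def)
  define g where "g a = a\<^sup>2 + (1 - a)\<^sup>2 / N" for a :: real
  have "\<exists>a. 1 / (N + 1) \<le> a \<and> a \<le> 1 \<and> g a = t"
  proof (rule IVT')
    define b where "b = 1 / (N + 1)"
    have b: "(N + 1) * b = 1" using N by (simp add: b_def)
    then have "1 - b = N * b" by (simp add: algebra_simps)
    then have "g b = b\<^sup>2 + (N * b)\<^sup>2 / N" by (simp only: g_def)
    also have "\<dots> = b * ((N + 1) * b)"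
      using N by (simp add: field_simps power2_eq_square)
    finally have "g b = b * ((N + 1) * b)" .
    then have "g (1 / (N + 1)) = 1 / (N + 1)"
      unfolding b by (simp add: b_def)
    also have "\<dots> \<le> inverse N" using N by (simp add: field_simps)
    also have "\<dots> \<le> t" using n by (simp add: N_def)
    finally show "g (1 / (N + 1)) \<le> t" .
    show "continuous_on {1 / (N + 1)..1} g"
      unfolding g_def using N by (intro continuous_intros) auto
  qed (use assms N in \<open>auto simp: g_def\<close>)
  then obtain a where a: "0 \<le> a" "a \<le> 1" "g a = t"
    using N by (metis add_nonneg_nonneg divide_nonneg_nonneg order_trans zero_le_one)
  define f where "f i = (if i = 0 then a else (1 - a) / N)" for i :: nat
  have split: "{..Suc n} = insert 0 {1..Suc n}" by auto
  have sumf: "(\<Sum>i\<le>Suc n. f i) = 1"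
    unfolding split using N by (simp add: f_def N_def field_simps)
  have sumf2: "(\<Sum>i\<le>Suc n. (f i)\<^sup>2) = t"
  proof -
    have "(\<Sum>i\<le>Suc n. (f i)\<^sup>2) = a\<^sup>2 + N * ((1 - a) / N)\<^sup>2"
      unfolding split by (simp add: f_def N_def)
    also have "\<dots> = g a" using N by (simp add: g_def power2_eq_square)
    finally show ?thesis using a(3) by simp
  qed
  have f0: "0 \<le> f i" for i using a N by (simp add: f_def)
  obtain r where pr: "\<And>i. pmf r i = (if i \<in> {..Suc n} then f i else 0)"
    and sup: "set_pmf r \<subseteq> {..Suc n}"
    using exists_pmf_finite_support[OF finite_atMost f0 sumf] by blast
  have fin: "finite (set_pmf r)" using sup by (rule finite_subset) simp
  have "pmf (distance_law r (=)) True = measure (pair_pmf r r) ((\<lambda>i. (i, i)) ` {..Suc n})"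
    unfolding distance_law_def pmf_map
    using sup by (intro measure_pmf.finite_measure_eq_AE) (auto simp: AE_measure_pmf_iff)
  also have "\<dots> = (\<Sum>i\<le>Suc n. pmf (pair_pmf r r) (i, i))"
    by (subst measure_measure_pmf_finite) (auto simp: sum.reindex inj_on_def)
  also have "\<dots> = t" using sumf2 by (simp add: pmf_pair pr power2_eq_square)
  finally have T: "pmf (distance_law r (=)) True = t" .
  have "distance_law r (=) = bernoulli_pmf t"
  proof (rule pmf_eqI)
    fix b show "pmf (distance_law r (=)) b = pmf (bernoulli_pmf t) b"
      using T assms by (cases b) (auto simp: pmf_False_conv_True)
  qed
  with fin show ?thesis by blast
qed

section \<open>Gluing copies of a space at a common distance\<close>

definition glue :: "'c \<Rightarrow> ('a \<Rightarrow> 'a \<Rightarrow> 'c) \<Rightarrow> 'b \<times> 'a \<Rightarrow> 'b \<times> 'a \<Rightarrow> 'c" where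
  "glue D l u v = (if fst u = fst v then l (snd u) (snd v) else D)"

lemma ultrametric_on_glue:
  assumes "ultrametric_on S l" "\<And>x y. x \<in> S \<Longrightarrow> y \<in> S \<Longrightarrow> l x y \<le> D" "0 < D"
  shows "ultrametric_on (R \<times> S) (glue D l)"
  using assms unfolding ultrametric_on_def glue_def
  by (auto simp: le_max_iff_disj)

text \<open>
  Draw the two copies first and the two points inside them afterwards: by independence, the law
  of the distance depends on the copies only through whether they are the same one.
\<close>
lemma distance_law_glue:
  "distance_law (pair_pmf r M) (glue D l) =
     bind_pmf (distance_law r (=)) (\<lambda>e. if e then distance_law M l else return_pmf D)"
proof -
  have "distance_law (pair_pmf r M) (glue D l) =
      bind_pmf r (\<lambda>a. bind_pmf M (\<lambda>x. bind_pmf r (\<lambda>b. bind_pmf M (\<lambda>y.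
        return_pmf (if a = b then l x y else D)))))"
    by (simp add: distance_law_def map_pmf_def pair_pmf_def bind_assoc_pmf bind_return_pmf glue_def
        cong: if_cong)
  also have "\<dots> = bind_pmf r (\<lambda>a. bind_pmf r (\<lambda>b. bind_pmf M (\<lambda>x. bind_pmf M (\<lambda>y.
        return_pmf (if a = b then l x y else D)))))"
    by (subst bind_commute_pmf) (rule refl)
  also have "\<dots> = bind_pmf r (\<lambda>a. bind_pmf r (\<lambda>b.
        if a = b then distance_law M l else return_pmf D))"
    by (intro bind_pmf_cong refl)
      (simp add: distance_law_def map_pmf_def pair_pmf_def bind_assoc_pmf bind_return_pmf)
  finally show ?thesis
    by (simp add: distance_law_def map_pmf_def pair_pmf_def bind_assoc_pmf bind_return_pmf)
qed

text \<open>
  Sampling \<open>Q\<close> amounts to deciding whether the top value \<open>k + 1\<close> occurs and, if it does not,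
  sampling the conditional law. This matches the right-hand side of \<open>distance_law_glue\<close>.
\<close>
lemma pmf_eq_bernoulli_cond:
  fixes Q :: "nat pmf"
  assumes "set_pmf Q \<subseteq> {..Suc k}" "0 \<in> set_pmf Q"
  shows "Q = bind_pmf (bernoulli_pmf (1 - pmf Q (Suc k)))
               (\<lambda>e. if e then cond_pmf Q {..k} else return_pmf (Suc k))"
proof (rule pmf_eqI)
  fix i
  let ?t = "1 - pmf Q (Suc k)"
  have ne: "set_pmf Q \<inter> {..k} \<noteq> {}" using assms(2) by auto
  have "measure Q {..k} = measure Q (- {Suc k})"
    using assms(1) by (intro measure_pmf.finite_measure_eq_AE) (auto simp: AE_measure_pmf_iff)
  then have m: "measure Q {..k} = ?t"
    by (simp add: measure_pmf.prob_compl[of "{Suc k}" Q, simplified] Compl_eq_Diff_UNIV measure_pmf_single)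
  have t: "0 < ?t" "?t \<le> 1"
    using m ne by (simp_all add: measure_pmf_posI[of 0] assms(2) flip: m)
  have "i \<notin> {..Suc k} \<Longrightarrow> pmf Q i = 0"
    using assms(1) by (auto simp: set_pmf_iff)
  then show "pmf Q i = pmf (bind_pmf (bernoulli_pmf ?t)
               (\<lambda>e. if e then cond_pmf Q {..k} else return_pmf (Suc k))) i"
    using t by (auto simp: pmf_bind pmf_cond[OF ne] m indicator_def le_Suc_eq)
qed

text \<open>
  The condition \<open>0 \<in> set_pmf Q\<close> cannot be avoided: \<open>M\<close> has an atom, so two independent samples
  coincide with positive probability. The points are natural numbers so that the carrier
  type stays the same through the induction; pairs are encoded by \<open>prod_encode\<close>.
\<close>
lemma exists_ultrametric_law:
  fixes Q :: "nat pmf"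
  assumes "set_pmf Q \<subseteq> {..k}" "0 \<in> set_pmf Q"
  shows "\<exists>(M :: nat pmf) l. finite (set_pmf M) \<and> ultrametric_on (set_pmf M) l \<and> distance_law M l = Q"
  using assms
proof (induction k arbitrary: Q)
  case 0
  then have "Q = return_pmf 0" by (simp add: set_pmf_subset_singleton)
  then have "finite (set_pmf (return_pmf (0::nat))) \<and>
      ultrametric_on (set_pmf (return_pmf 0)) (\<lambda>_ _. 0::nat) \<and>
      distance_law (return_pmf (0::nat)) (\<lambda>_ _. 0) = Q"
    by (simp add: ultrametric_on_def distance_law_def pair_return_pmf1)
  then show ?case by blast
next
  case (Suc k)
  define t where "t = 1 - pmf Q (Suc k)"
  define Q' where "Q' = cond_pmf Q {..k}"
  have ne: "set_pmf Q \<inter> {..k} \<noteq> {}" using Suc.prems by auto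
  have set': "set_pmf Q' = set_pmf Q \<inter> {..k}"
    unfolding Q'_def by (rule set_cond_pmf[OF ne])
  with Suc.prems obtain M :: "nat pmf" and l where
    M: "finite (set_pmf M)" "ultrametric_on (set_pmf M) l" "distance_law M l = Q'"
    using Suc.IH[of Q'] by auto
  have "pmf Q (Suc k) + pmf Q 0 \<le> 1"
    using measure_pmf.prob_le_1[of Q "{Suc k, 0}"] by (simp add: measure_measure_pmf_finite)
  moreover have "pmf Q 0 > 0" using Suc.prems(2) by (simp add: pmf_positive)
  ultimately obtain r :: "nat pmf" where
    r: "finite (set_pmf r)" "distance_law r (=) = bernoulli_pmf t"
    using exists_pmf_collision[of t] by (auto simp: t_def)
  have le: "l x y \<le> Suc k" if "x \<in> set_pmf M" "y \<in> set_pmf M" for x y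
  proof -
    have "l x y \<in> set_pmf Q'" using that unfolding M(3)[symmetric] set_distance_law by blast
    then show ?thesis by (simp add: set')
  qed
  let ?M = "pair_pmf r M" and ?l = "glue (Suc k) l"
  have um: "ultrametric_on (set_pmf ?M) ?l"
    unfolding set_pair_pmf using M(2) le by (intro ultrametric_on_glue) auto
  have law: "distance_law ?M ?l = Q"
    unfolding distance_law_glue r(2) M(3) t_def Q'_def
    by (rule pmf_eq_bernoulli_cond[symmetric]) (fact Suc.prems)+
  have inj: "inj prod_encode" by (rule inj_prod_encode)
  show ?case
    using ultrametric_on_image[OF inj um] distance_law_map[OF inj, of ?M ?l] law r(1) M(1)
    by (intro exI[of _ "map_pmf prod_encode ?M"]
          exI[of _ "\<lambda>x y. ?l (inv prod_encode x) (inv prod_encode y)"]) simp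
qed

section \<open>From integer ultrametrics to metric measure spaces\<close>

text \<open>
  Applying the increasing function \<open>d\<close> preserves the ultrametric inequality, hence yields the
  triangle inequality however the gaps of \<open>d\<close> are distributed. A \<open>Metric_space\<close> must be nonnegative
  and symmetric even off its carrier, where \<open>l\<close> is arbitrary; so \<open>\<rho>\<close> agrees with \<open>d (l x y)\<close> on the
  carrier only.
\<close>
lemma Metric_space_of_ultrametric:
  fixes l :: "'a \<Rightarrow> 'a \<Rightarrow> nat" and d :: "nat \<Rightarrow> real"
  assumes "ultrametric_on S l" "\<And>x y. x \<in> S \<Longrightarrow> y \<in> S \<Longrightarrow> l x y \<le> k"
    and "d 0 = 0" "strict_mono_on {..k} d"
  obtains \<rho> where "Metric_space S \<rho>" "\<And>x y. x \<in> S \<Longrightarrow> y \<in> S \<Longrightarrow> \<rho> x y = d (l x y)"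
proof -
  define \<rho> where "\<rho> x y = (if x \<in> S \<and> y \<in> S then d (l x y) else 0)" for x y
  have mono: "i \<le> j \<Longrightarrow> j \<le> k \<Longrightarrow> d i \<le> d j" for i j
    using strict_mono_on_leD[OF assms(4)] by auto
  have nonneg: "j \<le> k \<Longrightarrow> 0 \<le> d j" for j
    using mono[of 0 j] assms(3) by simp
  have pos: "d j = 0 \<longleftrightarrow> j = 0" if "j \<le> k" for j
    using strict_mono_onD[OF assms(4), of 0 j] assms(3) that by (cases "j = 0") auto
  have sym: "l x y = l y x" "l x y = 0 \<longleftrightarrow> x = y" if "x \<in> S" "y \<in> S" for x y
    using assms(1) that by (auto simp: ultrametric_on_def)
  show ?thesis
  proof
    show "Metric_space S \<rho>"
    proof
      fix x y show "0 \<le> \<rho> x y" using nonneg assms(2) by (simp add: \<rho>_def)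
      show "\<rho> x y = \<rho> y x" using sym by (simp add: \<rho>_def)
    next
      fix x y assume "x \<in> S" "y \<in> S"
      then show "\<rho> x y = 0 \<longleftrightarrow> x = y" using sym pos assms(2) by (simp add: \<rho>_def)
    next
      fix x y z assume S: "x \<in> S" "y \<in> S" "z \<in> S"
      then have "l x z \<le> max (l x y) (l y z)"
        using assms(1) by (auto simp: ultrametric_on_def)
      then have "d (l x z) \<le> max (d (l x y)) (d (l y z))"
        using mono assms(2) S by (auto simp: le_max_iff_disj)
      then show "\<rho> x z \<le> \<rho> x y + \<rho> y z"
        using S nonneg[OF assms(2)[of x y]] nonneg[OF assms(2)[of y z]] by (auto simp: \<rho>_def)
    qed
  qed (auto simp: \<rho>_def)
qed

text \<open>
  A finite metric space is discrete, so its Borel sets are all subsets. The restriction to \<open>S\<close> is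
  there because the space of \<open>measure_pmf M\<close> is the whole type.
\<close>
lemma borel_probability_on_finite:
  assumes "Metric_space S \<rho>" "finite S" "set_pmf M = S"
  shows "borel_probability_on (Metric_space.mtopology S \<rho>) (restrict_space M S)"
proof -
  interpret Metric_space S \<rho> by fact
  have disc: "mtopology = discrete_topology S"
    using finite_t1_space_imp_discrete_topology[of mtopology S] assms(2)
    by (simp add: Hausdorff_imp_t1_space Hausdorff_space_mtopology)
  have "{U. openin mtopology U} = Pow S" by (auto simp: disc)
  moreover have "sigma_sets S (Pow S) = Pow S"
    by (rule sigma_algebra.sigma_sets_eq[OF sigma_algebra_Pow])
  moreover have "sets (restrict_space M S) = Pow S"
    by (auto simp: sets_restrict_space)
  moreover have "emeasure M S = 1"
    unfolding assms(3)[symmetric] by (rule measure_pmf.emeasure_eq_1_AE) (auto simp: AE_measure_pmf)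
  then have "prob_space (restrict_space M S)"
    by (intro prob_space_restrict_space) auto
  ultimately show ?thesis
    unfolding borel_probability_on_def
    by (simp add: space_restrict_space)
qed

text \<open>
  This turns the product measure into a probability mass function, so that events about two
  independent points can be computed with \<open>pair_pmf\<close>.
\<close>
lemma pair_restrict_pmf_finite:
  assumes "finite S" "set_pmf M = S"
  shows "restrict_space M S \<Otimes>\<^sub>M restrict_space M S = restrict_space (pair_pmf M M) (S \<times> S)"
proof (rule measure_eqI)
  let ?m = "restrict_space (measure_pmf M) S"
  have "sets ?m = Pow S"
    by (auto simp: sets_restrict_space)
  then have sets: "sets (?m \<Otimes>\<^sub>M ?m) = Pow (S \<times> S)"
    using assms(1) by (intro sets_pair_countable) (auto intro: countable_finite)
  show "sets (?m \<Otimes>\<^sub>M ?m) = sets (restrict_space (pair_pmf M M) (S \<times> S))"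
    unfolding sets by (auto simp: sets_restrict_space)
  interpret m: prob_space ?m
    using measure_pmf.emeasure_eq_1_AE[of S M] assms(2)
    by (intro prob_space_restrict_space) (auto simp: AE_measure_pmf_iff)
  fix X assume "X \<in> sets (?m \<Otimes>\<^sub>M ?m)"
  then have X: "X \<subseteq> S \<times> S" by (simp add: sets)
  then have fin: "finite X" using assms(1) by (meson finite_SigmaI finite_subset)
  have "emeasure (?m \<Otimes>\<^sub>M ?m) X = (\<Sum>z\<in>X. emeasure (?m \<Otimes>\<^sub>M ?m) {z})"
    using X by (intro emeasure_eq_sum_singleton fin) (auto simp: sets)
  also have "\<dots> = (\<Sum>z\<in>X. ennreal (pmf (pair_pmf M M) z))"
  proof (rule sum.cong[OF refl])
    fix z assume z: "z \<in> X"
    obtain x y where xy: "z = (x, y)" by fastforce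
    have "emeasure (?m \<Otimes>\<^sub>M ?m) ({x} \<times> {y}) = emeasure ?m {x} * emeasure ?m {y}"
      using z xy X by (intro m.emeasure_pair_measure_Times) (auto simp: \<open>sets ?m = Pow S\<close>)
    then show "emeasure (?m \<Otimes>\<^sub>M ?m) {z} = ennreal (pmf (pair_pmf M M) z)"
      using z xy X
      by (auto simp: emeasure_restrict_space emeasure_pmf_single pmf_pair ennreal_mult subset_eq)
  qed
  also have "\<dots> = emeasure (restrict_space (pair_pmf M M) (S \<times> S)) X"
    using X fin by (simp add: emeasure_restrict_space emeasure_measure_pmf_finite)
  finally show "emeasure (?m \<Otimes>\<^sub>M ?m) X = emeasure (restrict_space (pair_pmf M M) (S \<times> S)) X" .
qed

text \<open>
  The distance of two independent points of \<open>M\<close> is the image under \<open>d\<close> of an integer with law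
  \<open>distance_law M l\<close>, and the image of a law on \<open>{0, \<dots>, k}\<close> is a mixture of Dirac masses at the
  points \<open>d i\<close>.
\<close>
lemma achieves_distance_law:
  fixes l :: "'a \<Rightarrow> 'a \<Rightarrow> nat" and d :: "nat \<Rightarrow> real"
  assumes \<rho>: "Metric_space S \<rho>" "\<And>x y. x \<in> S \<Longrightarrow> y \<in> S \<Longrightarrow> \<rho> x y = d (l x y)"
    and S: "finite S" "set_pmf M = S"
    and le: "\<And>x y. x \<in> S \<Longrightarrow> y \<in> S \<Longrightarrow> l x y \<le> k"
    and d: "\<And>i. i \<le> k \<Longrightarrow> 0 \<le> d i"
  shows "achieves S \<rho> (restrict_space M S) (dirac_mixture k (pmf (distance_law M l)) d)"
proof -
  let ?m = "restrict_space (measure_pmf M) S"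
  let ?P = "pair_pmf M M" and ?Q = "distance_law M l"
  have meas: "(\<lambda>(x, y). \<rho> x y) \<in> measurable (?m \<Otimes>\<^sub>M ?m) borel_Rplus"
    unfolding pair_restrict_pmf_finite[OF S] using Metric_space.nonneg[OF \<rho>(1)]
    by (intro measurable_restrict_space1) (auto simp: space_restrict_space)
  have "distr (?m \<Otimes>\<^sub>M ?m) borel_Rplus (\<lambda>(x, y). \<rho> x y) = dirac_mixture k (pmf ?Q) d"
  proof (rule measure_eqI)
    fix A assume "A \<in> sets (distr (?m \<Otimes>\<^sub>M ?m) borel_Rplus (\<lambda>(x, y). \<rho> x y))"
    then have A: "A \<in> sets borel_Rplus" by simp
    have "emeasure (distr (?m \<Otimes>\<^sub>M ?m) borel_Rplus (\<lambda>(x, y). \<rho> x y)) A =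
        emeasure ?P ({(x, y). \<rho> x y \<in> A} \<inter> S \<times> S)"
      unfolding emeasure_distr[OF meas A] unfolding pair_restrict_pmf_finite[OF S]
      by (subst emeasure_restrict_space)
        (auto simp: space_restrict_space intro!: arg_cong[where f = "emeasure ?P"])
    also have "\<dots> = emeasure ?P ((\<lambda>(x, y). l x y) -` {i. i \<le> k \<and> d i \<in> A})"
      using S \<rho>(2) le by (intro emeasure_eq_AE) (auto simp: AE_measure_pmf_iff)
    also have "\<dots> = emeasure ?Q {i \<in> {..k}. d i \<in> A}"
      by (simp add: distance_law_def)
    also have "\<dots> = (\<Sum>i\<in>{i \<in> {..k}. d i \<in> A}. ennreal (pmf ?Q i))"
      by (simp add: emeasure_measure_pmf_finite)
    also have "\<dots> = (\<Sum>i\<le>k. ennreal (pmf ?Q i) * emeasure (return borel_Rplus (d i)) A)"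
      using A d by (subst sum.inter_filter, simp, intro sum.cong refl) (simp add: indicator_def)
    finally show "emeasure (distr (?m \<Otimes>\<^sub>M ?m) borel_Rplus (\<lambda>(x, y). \<rho> x y)) A =
        emeasure (dirac_mixture k (pmf ?Q) d) A"
      by (simp add: emeasure_dirac_mixture[OF A])
  qed simp
  then show ?thesis
    using achieves_iff_distr_pair[OF \<rho>(1) borel_probability_on_finite[OF \<rho>(1) S] meas] by simp
qed

(* Every compact metric space has at most continuum many points, so a carrier S :: real set with an
   arbitrary metric \<rho> on it (unrelated to the usual one) covers all of them up to isometry. *)
theorem theorem1:
  fixes k :: nat and d p :: "nat \<Rightarrow> real"
  assumes "d 0 = 0"
    and "strict_mono_on {..k} d"
    and "\<And>i. i \<le> k \<Longrightarrow> p i \<in> {0<..<1}"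
    and "(\<Sum>i\<le>k. p i) = 1"
  shows "\<exists>(S :: real set) (\<rho> :: real \<Rightarrow> real \<Rightarrow> real) (\<mu> :: real measure).
           compact_measured_metric_space S \<rho> \<mu> \<and>
           achieves S \<rho> \<mu> (dirac_mixture k p d)"
proof -
  have p0: "0 \<le> p i" if "i \<in> {..k}" for i
    using assms(3)[of i] that by simp
  obtain Q where pr: "\<And>i. pmf Q i = (if i \<in> {..k} then p i else 0)" and "set_pmf Q \<subseteq> {..k}"
    using exists_pmf_finite_support[OF finite_atMost p0 assms(4)] by blast
  moreover have "0 \<in> set_pmf Q"
    using assms(3)[of 0] by (simp add: set_pmf_iff pr)
  ultimately obtain N :: "nat pmf" and l where
    N: "finite (set_pmf N)" "ultrametric_on (set_pmf N) l" "distance_law N l = Q"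
    using exists_ultrametric_law by blast
  \<comment> \<open>The carrier type is \<open>real\<close>; \<open>real\<close> serves only to relabel the points.\<close>
  define M where "M = map_pmf real N"
  define m where "m x y = l (inv real x) (inv real y)" for x y
  let ?S = "set_pmf M"
  have inj: "inj real" by (rule inj_of_nat)
  have fin: "finite ?S" and um: "ultrametric_on ?S m" and law: "distance_law M m = Q"
    using N ultrametric_on_image[OF inj N(2)] distance_law_map[OF inj, of N l]
    by (simp_all add: M_def m_def[abs_def])
  have le: "m x y \<le> k" if "x \<in> ?S" "y \<in> ?S" for x y
    using that \<open>set_pmf Q \<subseteq> {..k}\<close> set_distance_law[of M m] unfolding law by fastforce
  obtain \<rho> where \<rho>: "Metric_space ?S \<rho>"
    "\<And>x y. x \<in> ?S \<Longrightarrow> y \<in> ?S \<Longrightarrow> \<rho> x y = d (m x y)"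
    using Metric_space_of_ultrametric[OF um le assms(1,2)] by blast
  have d0: "0 \<le> d i" if "i \<le> k" for i
    using strict_mono_on_leD[OF assms(2), of 0 i] that assms(1) by simp
  have "dirac_mixture k (pmf Q) d = dirac_mixture k p d"
    unfolding dirac_mixture_def by (intro arg_cong[where f = "measure_of _ _"] ext sum.cong)
      (simp_all add: pr)
  then have "achieves ?S \<rho> (restrict_space M ?S) (dirac_mixture k p d)"
    using achieves_distance_law[OF \<rho> fin refl le d0] by (simp add: law)
  moreover have "compact_space (Metric_space.mtopology ?S \<rho>)"
    using fin finite_imp_compactin[of ?S "Metric_space.mtopology ?S \<rho>"]
    by (simp add: compact_space_def Metric_space.topspace_mtopology[OF \<rho>(1)])
  ultimately show ?thesis
    unfolding compact_measured_metric_space_def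
    using \<rho>(1) borel_probability_on_finite[OF \<rho>(1) fin refl] by blast
qed

end
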